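(* Let $f:H\to\mathbb{R}$ be $\mu$-strongly convex ($\mu>0$) and twice differentiable, with minimum value $f^*$. Let $s>0$ and let $x:[0,\infty)\to H$ be a solution of $$\ddot{x}(t)+2\sqrt{\mu}\,\dot{x}(t)+\sqrt{s}\,\nabla^2 f(x(t))\dot{x}(t)+\left(1+\sqrt{\mu s}\right)\nabla f(x(t))=0$$ with $x(0)=x_0$ and $\dot{x}(0)=v_0=-\sqrt{s}\,\nabla f(x_0)$. Then, for every $t\ge 0$, $$f(x(t))-f^*\le 2\left(f(x_0)-f^*\right)e^{-\sqrt{\mu}\,t}.$$ Moreover, $$\int_0^\infty e^{\sqrt{\mu}\,t}\|\nabla f(x(t))\|^2\,dt<\infty.$$
   Context: $H$ is a real Hilbert space with inner product $\langle\cdot,\cdot\rangle$ and norm $\|\cdot\|$. The function $f$ attains its minimum $f^*=\min(f)$. A differentiable $f$ is $\mu$-strongly convex if $f(y)\ge f(x)+\langle\nabla f(x),y-x\rangle+\frac{\mu}{2}\|x-y\|^2$ for all $x,y\in H$. *)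

theory Defs
  imports "HOL-Analysis.Analysis"
begin

definition gradient :: "('a::real_inner \<Rightarrow> real) \<Rightarrow> 'a \<Rightarrow> 'a" where
  "gradient f x = (THE D. GDERIV f x :> D)"

lemma gradient_eqI:
  assumes "GDERIV f x :> D"
  shows "gradient f x = D"
  unfolding gradient_def
proof (rule the_equality[where P = "\<lambda>D. GDERIV f x :> D", OF assms])
  fix D' assume "GDERIV f x :> D'"
  then have "(\<lambda>h. inner h D') = (\<lambda>h. inner h D)"
    using assms unfolding gderiv_def by (rule has_derivative_unique)
  then show "D' = D"
    by (metis inner_commute vector_eq_ldot)
qed

definition hessian :: "('a::real_inner \<Rightarrow> real) \<Rightarrow> 'a \<Rightarrow> 'a \<Rightarrow> 'a" where
  "hessian f x = frechet_derivative (gradient f) (at x)"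

(* On a Hilbert space a differentiable f has a gradient everywhere (Riesz), so the second
   conjunct is about the genuine gradient map. *)
definition twice_differentiable :: "('a::{real_inner,complete_space} \<Rightarrow> real) \<Rightarrow> bool" where
  "twice_differentiable f \<longleftrightarrow>
     (\<forall>x. f differentiable (at x)) \<and> (\<forall>x. gradient f differentiable (at x))"

(* Meaningful only for differentiable f; differentiability is stated separately. *)
definition strongly_convex :: "real \<Rightarrow> ('a::real_inner \<Rightarrow> real) \<Rightarrow> bool" where
  "strongly_convex \<mu> f \<longleftrightarrow>
     (\<forall>x y. f y \<ge> f x + inner (gradient f x) (y - x) + \<mu> / 2 * (norm (x - y))\<^sup>2)"

end

theory Submission
  imports Defs
begin

text \<open>With \<open>g(t) = \<nabla>f(x(t))\<close> and \<open>x\<^sup>*\<close> the minimiser, the Lyapunov function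
  \<open>E = f(x) - f\<^sup>* + \<parallel>\<surd>\<mu> (x - x\<^sup>*) + x' + \<surd>s g\<parallel>\<^sup>2 / 2\<close> satisfies
  \<open>E' + \<surd>\<mu> E \<le> -\<surd>s \<parallel>g\<parallel>\<^sup>2\<close> along solutions. Integrating the derivative of
  \<open>exp(\<surd>\<mu> t) E(t)\<close> gives both claims; the choice of \<open>x'(0)\<close> cancels the gradient in \<open>E(0)\<close>,
  so that \<open>E(0) \<le> 2 (f(x\<^sub>0) - f\<^sup>*)\<close> by strong convexity.\<close>

section \<open>Gradients of strongly convex functions\<close>

text \<open>The gradient inequality makes \<open>y \<mapsto> f y - \<langle>gradient f x, y\<rangle>\<close> minimal at \<open>x\<close>, so that
  \<open>gradient f x\<close> is the genuine gradient without recourse to the Riesz representation theorem.\<close>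

lemma strongly_convex_GDERIV:
  assumes "strongly_convex \<mu> f" "\<mu> \<ge> 0" "f differentiable (at x)"
  shows "GDERIV f x :> gradient f x"
proof -
  obtain f' where f': "(f has_derivative f') (at x)"
    using assms(3) unfolding differentiable_def by blast
  define F where "F = (\<lambda>y. f y - inner y (gradient f x))"
  have dF: "(F has_derivative (\<lambda>h. f' h - inner h (gradient f x))) (at x)"
    unfolding F_def by (intro has_derivative_diff f' has_derivative_inner_left has_derivative_ident)
  have "F x \<le> F y" for y
  proof -
    have "f x + inner (gradient f x) (y - x) + \<mu> / 2 * (norm (x - y))\<^sup>2 \<le> f y"
      using assms(1) unfolding strongly_convex_def by blast
    moreover have "0 \<le> \<mu> / 2 * (norm (x - y))\<^sup>2"
      using assms(2) by simp
    ultimately show ?thesis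
      by (simp add: F_def inner_diff_right inner_commute)
  qed
  then have "(\<lambda>h. f' h - inner h (gradient f x)) = (\<lambda>h. 0)"
    using differential_zero_maxmin[of x UNIV F, OF _ _ dF] by auto
  then have "f' = (\<lambda>h. inner h (gradient f x))"
    by (auto simp: fun_eq_iff)
  with f' show ?thesis
    by (simp add: gderiv_def)
qed

lemma GDERIV_minimum:
  fixes f :: "'a::real_inner \<Rightarrow> real"
  assumes "GDERIV f z :> D" "\<And>y. f z \<le> f y"
  shows "D = 0"
proof -
  have "(\<lambda>h. inner h D) = (\<lambda>h. 0)"
    using differential_zero_maxmin[of z UNIV f] assms by (auto simp: gderiv_def)
  then have "inner D D = 0"
    by metis
  then show ?thesis
    by simp
qed

text \<open>The gradient vanishes at a minimiser, so the linear term of the gradient inequality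
  based at \<open>z\<close> drops out. This controls the quadratic part of the initial
  energy.\<close>

lemma strongly_convex_growth:
  assumes "strongly_convex \<mu> f" "\<mu> \<ge> 0" "f differentiable (at z)" "\<And>y. f z \<le> f y"
  shows "\<mu> / 2 * (norm (y - z))\<^sup>2 \<le> f y - f z"
proof -
  have "gradient f z = 0"
    by (rule GDERIV_minimum[OF strongly_convex_GDERIV[OF assms(1-3)] assms(4)])
  moreover have "f z + inner (gradient f z) (y - z) + \<mu> / 2 * (norm (z - y))\<^sup>2 \<le> f y"
    using assms(1) unfolding strongly_convex_def by blast
  ultimately show ?thesis
    by (simp add: norm_minus_commute)
qed

section \<open>Chain rules along a curve and the pointwise Lyapunov estimate\<close>

lemma GDERIV_chain_vector:
  fixes f :: "'a::real_inner \<Rightarrow> real"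
  assumes "GDERIV f (x t) :> D" "(x has_vector_derivative x') (at t within S)"
  shows "((\<lambda>t. f (x t)) has_real_derivative inner D x') (at t within S)"
proof -
  have "((\<lambda>t. f (x t)) has_derivative (\<lambda>h. inner (h *\<^sub>R x') D)) (at t within S)"
    using assms has_derivative_compose unfolding gderiv_def has_vector_derivative_def by blast
  then show ?thesis
    unfolding has_field_derivative_def
    by (rule has_derivative_eq_rhs) (simp add: fun_eq_iff inner_commute[of D])
qed

lemma hessian_chain_vector:
  fixes f :: "'a::real_inner \<Rightarrow> real"
  assumes "gradient f differentiable (at (x t))" "(x has_vector_derivative x') (at t within S)"
  shows "((\<lambda>t. gradient f (x t)) has_vector_derivative hessian f (x t) x') (at t within S)"
proof -
  have H: "(gradient f has_derivative hessian f (x t)) (at (x t))"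
    using assms(1) unfolding hessian_def frechet_derivative_works .
  then have "((\<lambda>t. gradient f (x t)) has_derivative (\<lambda>h. hessian f (x t) (h *\<^sub>R x'))) (at t within S)"
    using has_derivative_compose[OF assms(2)[unfolded has_vector_derivative_def]] by blast
  then show ?thesis
    using linear_scale[OF has_derivative_linear[OF H]]
    by (simp add: has_vector_derivative_def)
qed

text \<open>The algebra behind the decay of the energy, with \<open>u\<close> for
  \<open>x - z\<close>, \<open>v\<close> for the velocity, \<open>m\<close> and \<open>r\<close> for
  the roots of \<mu> and \<open>s\<close>, and \<open>\<phi>\<close> for \<open>f x - fstar\<close>.
  Once \<open>v + r *\<^sub>R g\<close> is taken as one variable, the cross terms cancel and what
  remains besides \<open>- r * (norm g)\<^sup>2\<close> is nonpositive.\<close>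

lemma lyapunov_inequality:
  fixes g u w v :: "'a::real_inner" and m r \<phi> :: real
  assumes "m \<ge> 0" "\<phi> + m\<^sup>2 / 2 * (norm u)\<^sup>2 \<le> inner u g"
  shows "inner g v + inner (m *\<^sub>R u + (v + r *\<^sub>R g)) (- (m *\<^sub>R (v + r *\<^sub>R g)) - g)
    + m * (\<phi> + (norm (m *\<^sub>R u + (v + r *\<^sub>R g)))\<^sup>2 / 2) \<le> - (r * (norm g)\<^sup>2)"
proof -
  define w where "w = v + r *\<^sub>R g"
  have v: "v = w - r *\<^sub>R g"
    by (simp add: w_def)
  have "inner g v + inner (m *\<^sub>R u + w) (- (m *\<^sub>R w) - g)
      + m * (\<phi> + (norm (m *\<^sub>R u + w))\<^sup>2 / 2)
    = m * (\<phi> + m\<^sup>2 / 2 * (norm u)\<^sup>2 - inner u g) - m / 2 * (norm w)\<^sup>2 - r * (norm g)\<^sup>2"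
    unfolding v power2_norm_eq_inner
    by (simp add: inner_add_left inner_add_right inner_diff_left inner_diff_right
        inner_commute[of g w] inner_commute[of g u] inner_commute[of w u] power2_eq_square field_simps)
  moreover have "m * (\<phi> + m\<^sup>2 / 2 * (norm u)\<^sup>2 - inner u g) \<le> 0"
    using assms by (intro mult_nonneg_nonpos) auto
  moreover have "0 \<le> m / 2 * (norm w)\<^sup>2"
    using assms by simp
  ultimately show ?thesis
    unfolding w_def by linarith
qed

section \<open>Integrating differential inequalities, and integrability on a half-line\<close>

lemma integral_le_of_deriv_le:
  fixes P P' h :: "real \<Rightarrow> real"
  assumes "a \<le> b"
    and "\<And>t. t \<in> {a..b} \<Longrightarrow> (P has_real_derivative P' t) (at t within {a..b})"
    and "\<And>t. t \<in> {a..b} \<Longrightarrow> P' t \<le> - h t"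
    and "continuous_on {a..b} h"
  shows "integral {a..b} h \<le> P a - P b"
proof -
  \<comment> \<open>The gauge integral integrates every derivative, so the pointwise bound on
    \<open>P'\<close> can be compared under the integral at once.\<close>
  have P: "(P' has_integral (P b - P a)) {a..b}"
    using assms(2) unfolding has_real_derivative_iff_has_vector_derivative
    by (intro fundamental_theorem_of_calculus assms(1)) auto
  have h: "((\<lambda>t. - h t) has_integral - integral {a..b} h) {a..b}"
    by (intro has_integral_neg integrable_integral integrable_continuous_interval assms)
  show ?thesis
    using has_integral_le[OF P h assms(3)] by simp
qed

lemma set_integrable_atLeast_bounded:
  fixes h :: "real \<Rightarrow> real"
  assumes cont: "continuous_on {a..} h"
    and nonneg: "\<And>t. t \<ge> a \<Longrightarrow> h t \<ge> 0"
    and bound: "\<And>b. b \<ge> a \<Longrightarrow> integral {a..b} h \<le> B"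
  shows "set_integrable lborel {a..} h"
proof -
  \<comment> \<open>Truncations of \<open>h\<close> to growing intervals: they increase to
    \<open>h\<close> pointwise, and their integrals stay in \<open>{0..B}\<close>, as monotone
    convergence requires.\<close>
  define k where "k = (\<lambda>n t. if t \<in> {a..a + real n} then h t else 0)"
  have h_int: "h integrable_on {a..b}" for b
    by (intro integrable_continuous_interval continuous_on_subset[OF cont]) auto
  have k_has: "(k n has_integral integral {a..a + real n} h) {a..}" for n
    unfolding k_def
    by (rule iffD2[OF has_integral_restrict integrable_integral[OF h_int]]) auto
  have "h integrable_on {a..} \<and> (\<lambda>n. integral {a..} (k n)) \<longlonglongrightarrow> integral {a..} h"
  proof (rule monotone_convergence_increasing)
    show "k n integrable_on {a..}" for n
      using k_has by blast
    show "k n t \<le> k (Suc n) t" if "t \<in> {a..}" for n t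
      using that nonneg by (auto simp: k_def)
    show "(\<lambda>n. k n t) \<longlonglongrightarrow> h t" if "t \<in> {a..}" for t
    proof -
      obtain N where "t - a \<le> real N"
        using real_arch_simple by blast
      then have "k n t = h t" if "n \<ge> N" for n
        using that \<open>t \<in> {a..}\<close> by (simp add: k_def)
      then have "\<forall>\<^sub>F n in sequentially. k n t = h t"
        unfolding eventually_sequentially by blast
      then show ?thesis
        by (rule tendsto_eventually)
    qed
    have "integral {a..} (k n) \<in> {0..B}" for n
    proof -
      have "0 \<le> integral {a..a + real n} h"
        by (intro integral_nonneg h_int nonneg) simp
      with bound[of "a + real n"] integral_unique[OF k_has[of n]] show ?thesis
        by simp
    qed
    then show "bounded (range (\<lambda>n. integral {a..} (k n)))"
      by (intro bounded_subset[OF bounded_closed_interval[of 0 B]]) blast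
  qed
  then have "h absolutely_integrable_on {a..}"
    using nonneg by (intro nonnegative_absolutely_integrable_1) auto
  \<comment> \<open>Absolute integrability refers to the completed measure; Borel measurability,
    from continuity, brings it back to \<open>lborel\<close>.\<close>
  moreover have "(\<lambda>t. indicator {a..} t *\<^sub>R h t) \<in> borel_measurable lborel"
    using borel_measurable_continuous_on_indicator[OF _ cont] by simp
  ultimately show ?thesis
    unfolding set_integrable_def using integrable_completion by blast
qed

section \<open>Decay and integrability along the trajectory\<close>

theorem corollary3:
  fixes f :: "'a::{real_inner,complete_space} \<Rightarrow> real"
    and \<mu> s fstar :: real
    and x x' x'' :: "real \<Rightarrow> 'a"
    and x0 v0 :: 'a
  assumes "\<mu> > 0"
    and "twice_differentiable f"
    and "strongly_convex \<mu> f"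
    and "fstar \<in> range f" and "\<And>y. fstar \<le> f y"
    and "s > 0"
    and "\<And>t. t \<ge> 0 \<Longrightarrow> (x has_vector_derivative x' t) (at t within {0..})"
    and "\<And>t. t \<ge> 0 \<Longrightarrow> (x' has_vector_derivative x'' t) (at t within {0..})"
    and "\<And>t. t \<ge> 0 \<Longrightarrow>
           x'' t + (2 * sqrt \<mu>) *\<^sub>R x' t + sqrt s *\<^sub>R hessian f (x t) (x' t)
             + (1 + sqrt (\<mu> * s)) *\<^sub>R gradient f (x t) = 0"
    and "x 0 = x0" and "x' 0 = v0" and "v0 = - (sqrt s *\<^sub>R gradient f x0)"
  shows "(\<forall>t\<ge>0. f (x t) - fstar \<le> 2 * (f x0 - fstar) * exp (- (sqrt \<mu> * t))) \<and>
         set_integrable lborel {0..} (\<lambda>t. exp (sqrt \<mu> * t) * (norm (gradient f (x t)))\<^sup>2)"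
proof -
  have diff: "f differentiable (at z)" "gradient f differentiable (at z)" for z
    using assms(2) unfolding twice_differentiable_def by auto
  note dx = assms(7) and dx' = assms(8) and ode = assms(9)
  note grad = strongly_convex_GDERIV[OF assms(3) less_imp_le[OF assms(1)] diff(1)]
  obtain z where z: "fstar = f z"
    using assms(4) by blast
  define m r where "m = sqrt \<mu>" and "r = sqrt s"
  have m: "m > 0" "m\<^sup>2 = \<mu>" and r: "r > 0"
    using assms(1,6) by (simp_all add: m_def r_def)
  define g where "g = (\<lambda>t. gradient f (x t))"
  define v where "v = (\<lambda>t. m *\<^sub>R (x t - z) + (x' t + r *\<^sub>R g t))"
  define E where "E = (\<lambda>t. f (x t) - fstar + (norm (v t))\<^sup>2 / 2)"
  define P where "P = (\<lambda>t. exp (m * t) * E t)"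
  define h where "h = (\<lambda>t. exp (m * t) * (norm (g t))\<^sup>2)"
  define E' where "E' = (\<lambda>t. inner (g t) (x' t) + inner (v t) (- (m *\<^sub>R (x' t + r *\<^sub>R g t)) - g t))"

  have dg: "(g has_vector_derivative hessian f (x t) (x' t)) (at t within {0..})" if "t \<ge> 0" for t
    unfolding g_def by (rule hessian_chain_vector[OF diff(2) dx[OF that]])
  \<comment> \<open>The Hessian damping is exactly the derivative of \<open>r *\<^sub>R g t\<close>,
    so the equation eliminates \<open>x''\<close> and the Hessian together;
    \<open>sqrt (\<mu> * s)\<close> becomes \<open>m * r\<close>.\<close>
  have dv: "(v has_vector_derivative - (m *\<^sub>R (x' t + r *\<^sub>R g t)) - g t) (at t within {0..})"
    if t: "t \<ge> 0" for t
  proof -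
    have "(v has_vector_derivative m *\<^sub>R (x' t - 0) + (x'' t + r *\<^sub>R hessian f (x t) (x' t)))
        (at t within {0..})"
      unfolding v_def
      by (intro derivative_intros dx[OF t] dx'[OF t] dg[OF t]
          bounded_linear.has_vector_derivative[OF bounded_linear_scaleR_right])
    moreover have "m *\<^sub>R (x' t - 0) + (x'' t + r *\<^sub>R hessian f (x t) (x' t))
        = - (m *\<^sub>R (x' t + r *\<^sub>R g t)) - g t"
    proof -
      have "x'' t + r *\<^sub>R hessian f (x t) (x' t) = - ((2 * m) *\<^sub>R x' t) - (1 + m * r) *\<^sub>R g t"
        using ode[OF t] by (simp add: m_def r_def g_def real_sqrt_mult algebra_simps eq_neg_iff_add_eq_0)
      then show ?thesis
        by (simp add: algebra_simps scaleR_2 flip: scaleR_scaleR)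
    qed
    ultimately show ?thesis
      by simp
  qed
  have dE: "(E has_real_derivative E' t) (at t within {0..})" if t: "t \<ge> 0" for t
  proof -
    have "((\<lambda>t. (norm (v t))\<^sup>2) has_real_derivative
        2 * inner (v t) (- (m *\<^sub>R (x' t + r *\<^sub>R g t)) - g t)) (at t within {0..})"
      unfolding power2_norm_eq_inner
      unfolding has_field_derivative_def
      by (rule has_derivative_eq_rhs[OF has_derivative_inner[OF dv[OF t, unfolded has_vector_derivative_def]
          dv[OF t, unfolded has_vector_derivative_def]]]) (auto simp: fun_eq_iff inner_commute[of _ "v t"])
    from DERIV_add[OF DERIV_diff[OF GDERIV_chain_vector[OF grad dx[OF t]] DERIV_const]
        DERIV_cdivide[OF this, of 2]]
    show ?thesis
      unfolding E_def E'_def g_def by simp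
  qed
  have dP: "(P has_real_derivative exp (m * t) * (E' t + m * E t)) (at t within {0..})"
    if t: "t \<ge> 0" for t
    unfolding P_def by (auto intro!: derivative_eq_intros dE[OF t] simp: algebra_simps)
  have P'_le: "exp (m * t) * (E' t + m * E t) \<le> - (r * h t)" for t
  proof -
    \<comment> \<open>The gradient inequality is based at \<open>x t\<close> and evaluated at the
      minimiser \<open>z\<close>, which yields the hypothesis of
      \<open>lyapunov_inequality\<close>.\<close>
    have "f z \<ge> f (x t) + inner (g t) (z - x t) + \<mu> / 2 * (norm (x t - z))\<^sup>2"
      using assms(3) unfolding strongly_convex_def g_def by blast
    then have "f (x t) - fstar + m\<^sup>2 / 2 * (norm (x t - z))\<^sup>2 \<le> inner (x t - z) (g t)"
      by (simp add: z m(2) inner_diff_left inner_diff_right inner_commute)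
    from lyapunov_inequality[OF less_imp_le[OF m(1)] this, of "x' t" r]
    have "E' t + m * E t \<le> - (r * (norm (g t))\<^sup>2)"
      unfolding E'_def E_def v_def by simp
    from mult_left_mono[OF this, of "exp (m * t)"]
    show ?thesis
      by (simp add: h_def mult.left_commute)
  qed
  have h_cont: "continuous_on {0..} h"
  proof -
    have "continuous_on {0..} g"
      using dg by (intro continuous_on_vector_derivative) auto
    then show ?thesis
      unfolding h_def by (intro continuous_intros)
  qed
  have h_nonneg: "h t \<ge> 0" for t
    by (simp add: h_def)
  \<comment> \<open>Both claims come from this bound: nonnegativity of the integral gives
    \<open>P b \<le> P 0\<close>, and nonnegativity of \<open>P b\<close> bounds the integral
    uniformly in \<open>b\<close>.\<close>
  have int_le: "r * integral {0..b} h \<le> P 0 - P b" if "b \<ge> 0" for b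
  proof -
    have "integral {0..b} (\<lambda>t. r * h t) \<le> P 0 - P b"
      using that
      by (intro integral_le_of_deriv_le[OF _ has_field_derivative_subset[OF dP] P'_le]
          continuous_intros continuous_on_subset[OF h_cont]) auto
    then show ?thesis
      by simp
  qed
  have int_nonneg: "integral {0..b} h \<ge> 0" for b
    by (intro integral_nonneg integrable_continuous_interval continuous_on_subset[OF h_cont])
      (auto simp: h_nonneg)
  have P0: "P 0 \<le> 2 * (f x0 - fstar)"
  proof -
    have "v 0 = m *\<^sub>R (x0 - z)"
      using assms(10-12) by (simp add: v_def g_def r_def)
    then have "P 0 = f x0 - fstar + \<mu> / 2 * (norm (x0 - z))\<^sup>2"
      using assms(10) by (simp add: P_def E_def power_mult_distrib m(2))
    \<comment> \<open>Quadratic growth at \<open>z\<close> absorbs the distance term into a second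
      copy of \<open>f x0 - f z\<close>, whence the factor 2.\<close>
    also have "\<dots> \<le> f x0 - fstar + (f x0 - f z)"
      using strongly_convex_growth[OF assms(3) less_imp_le[OF assms(1)] diff(1)] assms(5)
      unfolding z by (intro add_left_mono) auto
    finally show ?thesis
      by (simp add: z)
  qed
  have "f (x t) - fstar \<le> 2 * (f x0 - fstar) * exp (- (m * t))" if t: "t \<ge> 0" for t
  proof -
    have "exp (m * t) * (f (x t) - fstar) \<le> P t"
      unfolding P_def E_def by (intro mult_left_mono) auto
    also have "\<dots> \<le> P 0"
      using int_le[OF t] mult_nonneg_nonneg[OF less_imp_le[OF r] int_nonneg[of t]] by linarith
    also note P0
    finally show ?thesis
      by (simp add: exp_minus field_simps)
  qed
  moreover have "set_integrable lborel {0..} h"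
  proof (rule set_integrable_atLeast_bounded[OF h_cont h_nonneg])
    fix b :: real assume b: "b \<ge> 0"
    have "P b \<ge> 0"
      using assms(5)[of "x b"] by (simp add: P_def E_def)
    with int_le[OF b] have "r * integral {0..b} h \<le> P 0"
      by linarith
    then show "integral {0..b} h \<le> P 0 / r"
      using r by (simp add: field_simps)
  qed
  ultimately show ?thesis
    unfolding m_def h_def g_def by blast
qed

end
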